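(* Fix $\delta\in(1/2,1]$, $\alpha_0>0$, $0\le\omega_{\mathsf M}<\delta-1/2$, $\omega_{\mathsf B}>0$, $0\le\beta<\min\{\omega_{\mathsf B},\delta-\omega_{\mathsf M}-1/2\}$ and $c>0$. There is a class of processes, each satisfying the extended stochastic approximation recursion described in the context and all of the step-size (with this $\alpha_0,\delta$), compactness, ergodicity, kernel-continuity, growth, interior-target, quasi-strong-monotonicity and error (with these exponents $\omega_{\mathsf M},\omega_{\mathsf B}$) conditions of the context, together with $2\zeta\alpha_0>1$ when $\delta=1$, and all sharing common numerical values of the constants $N,\epsilon_0,\lambda,b,L_P,L_F,C_F,\zeta,C_{\mathsf M},C_{\mathsf B}$ in those conditions, with the following property. For each $\epsilon>0$, some process in this class satisfies $$\mathbb P\Bigl(\exists\,k\ge k_0:\ \|\theta_k-\theta^\star\|>c\,k^{-\beta}\,\Bigm|\,\mathcal G_0^+\Bigr)\ \ge\ C_\epsilon\,k_0^{-(2(\delta-\beta-\omega_{\mathsf M})-1+\epsilon)}\qquad\text{for all }k_0\ge K_\epsilon,$$ where $C_\epsilon$ and $K_\epsilon$ are some positive constants.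
   Context: Setting. $\|\cdot\|$ is the Euclidean norm and $\langle\cdot,\cdot\rangle$ the Euclidean inner product. A process consists of a set $\Theta\subseteq\mathbb R^d$, a Borel subset $\mathcal W$ of a Euclidean space, a jointly Borel measurable $F:\Theta\times\mathcal W\to\mathbb R^d$, a family $\{P_\theta:\theta\in\Theta\}$ of Markov transition kernels on $\mathcal W$ with $(\theta,w)\mapsto P_\theta(w,E)$ Borel measurable for each Borel $E$, and random sequences as follows. Write $(P_\theta f)(w):=\int f(y)P_\theta(w,dy)$, $P_\theta^k$ for the $k$-step kernel, $U_p(w):=1+\|w\|^p$ for $p\in\{1,2\}$, and $\Pi_\Theta$ for Euclidean projection onto $\Theta$. Extended recursion. $(\theta_0,W_0)$ is $\Theta\times\mathcal W$-valued and $$\theta_{k+1}=\Pi_\Theta\bigl(\theta_k+\alpha_k(F(\theta_k,W_k)+M_{k+1}+B_k)\bigr),\qquad k\ge0,$$ with $\mathbb R^d$-valued random vectors $M_{k+1},B_k$. Let $\chi_{k+1}$ be a random element collecting all information revealed during update $k$, including $M_{k+1}$, and set $\mathcal G_0^-:=\sigma(\theta_0,W_0)$, $\mathcal G_k^+:=\mathcal G_k^-\vee\sigma(\chi_{k+1})$, $\mathcal G_{k+1}^-:=\mathcal G_k^+\vee\sigma(W_{k+1})$ for $k\ge0$. The variables $\theta_k,W_k,B_k$ are $\mathcal G_k^-$-measurable, and $\mathbb P(W_{k+1}\in E\mid\mathcal G_k^+)=P_{\theta_k}(W_k,E)$ for all Borel $E$ and $k\ge0$. (In)equalities between random quantities hold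 almost surely. Constants are deterministic and do not depend on realizations of the initial variables. Conditions. - Step sizes: $\alpha_k=\alpha_0k^{-\delta}$ for all $k\ge1$ (the step size at $k=0$ is $\alpha_0$). - Compactness: $\Theta$ is nonempty, compact and convex. - Ergodicity: (i) each $P_\theta$ is irreducible and aperiodic (as a general-state-space chain); there are a positive integer $N$, a nonempty Borel set $\mathcal W_0\subseteq\mathcal W$, $\epsilon_0>0$ and a probability measure $\varphi$ on $\mathcal W$ with $P_\theta^N(w,E)\ge\epsilon_0\varphi(E)$ for all $\theta\in\Theta$, $w\in\mathcal W_0$ and Borel $E$; and there are constants $0\le\lambda<1$, $b\ge0$ with $(P_\theta U_2)(w)\le\lambda U_2(w)+b\,\mathbb I_{\mathcal W_0}(w)$ for all $\theta\in\Theta$, $w\in\mathcal W$. (ii) $\mathbb E[U_2(W_0)]<\infty$. Part (i) ensures that each $P_\theta$ has a unique stationary distribution $\nu_\theta$ with $\nu_\theta(U_2)<\infty$; set $\bar F(\theta):=\int_{\mathcal W}F(\theta,w)\,\nu_\theta(dw)$. - Kernel continuity: $L_P>0$ and $|(P_\theta f)(w)-(P_{\theta'}f)(w)|\le L_PU_1(w)\|\theta-\theta'\|$ for all $\theta,\theta'\in\Theta$, $w\in\mathcal W$ and Borel $f:\mathcal W\to\mathbb R$ with $|f|\le U_1$. - Growth: $L_F,C_F>0$ and $\|F(\theta,w)-F(\theta',w)\|\le L_F(1+\|w\|)\|\theta-\theta'\|$, $\sup_{\theta\in\Theta}\|F(\theta,w)\|\le C_F(1+\|w\|)$ for all $\theta,\theta'\in\Theta$,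 $w\in\mathcal W$. - Interior target: there is $\theta^\star\in\operatorname{int}(\Theta)$ with $\bar F(\theta^\star)=0$. - Quasi-strong monotonicity: $\zeta>0$ and $\langle\theta-\theta^\star,\bar F(\theta)\rangle\le-\zeta\|\theta-\theta^\star\|^2$ for all $\theta\in\Theta$. - Error condition: (i) for all $k\ge0$, $M_{k+1}$ is $\mathcal G_k^+$-measurable and conditionally square integrable, $\mathbb E[M_{k+1}\mid\mathcal G_k^-]=0$ and $\mathbb E[\|M_{k+1}\|^2\mid\mathcal G_k^-]\le\mathsf m_k^2U_2(W_k)$; (ii) for all $k\ge0$, $B_k$ is $\mathcal G_k^-$-measurable and $\|B_k\|\le\mathsf b_k$; (iii) $C_{\mathsf M},C_{\mathsf B}\ge0$ and the deterministic scales satisfy $\mathsf m_k\le C_{\mathsf M}(k+1)^{\omega_{\mathsf M}}$ and $\mathsf b_k\le C_{\mathsf B}(k+1)^{-\omega_{\mathsf B}}$ for all $k\ge0$. *)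

theory Defs
  imports "HOL-Probability.Probability"
begin

section \<open>Euclidean spaces of variable dimension\<close>

text \<open>
  The dimensions of the parameter space and of the state space belong to the data of a process and
  are existentially quantified, so they cannot be types.  The space of dimension \<open>n\<close> is the one
  of the library's \<^const>\<open>Euclidean_space\<close>: sequences \<open>x :: nat \<Rightarrow> real\<close> with
  \<open>x i = 0\<close> for all \<open>i \<ge> n\<close>, topologised as a subspace of the product topology.
  Since \<open>borel\<close> at type \<open>nat \<Rightarrow> real\<close> is generated by that same product topology, its
  trace is the usual Borel sigma-algebra.
\<close>

type_synonym rvec = "nat \<Rightarrow> real"

abbreviation Rn :: "nat \<Rightarrow> rvec set" where
  "Rn n \<equiv> topspace (Euclidean_space n)"

abbreviation borel_on :: "rvec set \<Rightarrow> rvec measure" where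
  "borel_on S \<equiv> restrict_space borel S"

definition vnorm :: "nat \<Rightarrow> rvec \<Rightarrow> real" where
  "vnorm n x = L2_set x {..<n}"

definition vdist :: "nat \<Rightarrow> rvec \<Rightarrow> rvec \<Rightarrow> real" where
  "vdist n x y = vnorm n (\<lambda>i. x i - y i)"

definition vinner :: "nat \<Rightarrow> rvec \<Rightarrow> rvec \<Rightarrow> real" where
  "vinner n x y = (\<Sum>i<n. x i * y i)"

definition vconvex :: "rvec set \<Rightarrow> bool" where
  "vconvex S \<longleftrightarrow>
     (\<forall>x\<in>S. \<forall>y\<in>S. \<forall>u. 0 \<le> u \<and> u \<le> 1 \<longrightarrow> (\<lambda>i. (1 - u) * x i + u * y i) \<in> S)"

definition vproj :: "nat \<Rightarrow> rvec set \<Rightarrow> rvec \<Rightarrow> rvec" where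
  "vproj n S x = arg_min_on (vdist n x) S"

definition U :: "nat \<Rightarrow> nat \<Rightarrow> rvec \<Rightarrow> real" where
  "U n p w = 1 + vnorm n w ^ p"


section \<open>General-state-space Markov chains\<close>

primrec kernel_pow :: "'a measure \<Rightarrow> ('a \<Rightarrow> 'a measure) \<Rightarrow> nat \<Rightarrow> 'a \<Rightarrow> 'a measure" where
  "kernel_pow S K 0 w = return S w"
| "kernel_pow S K (Suc k) w = Giry_Monad.bind (kernel_pow S K k w) K"

text \<open>
  Irreducibility and aperiodicity follow Meyn and Tweedie: a chain is irreducible if it has a
  nonzero irreducibility measure, and it is aperiodic if there is no cycle
  \<open>D 0 \<rightarrow> D 1 \<rightarrow> \<dots> \<rightarrow> D (n - 1) \<rightarrow> D 0\<close> of length \<open>n \<ge> 2\<close> through pairwise disjoint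
  sets whose union is full for a maximal irreducibility measure.
\<close>

definition irreducibility_measure :: "'a measure \<Rightarrow> ('a \<Rightarrow> 'a measure) \<Rightarrow> 'a measure \<Rightarrow> bool" where
  "irreducibility_measure S K \<phi> \<longleftrightarrow>
     sigma_finite_measure \<phi> \<and> sets \<phi> = sets S \<and> emeasure \<phi> (space \<phi>) \<noteq> 0 \<and>
     (\<forall>E\<in>sets S. emeasure \<phi> E > 0 \<longrightarrow>
        (\<forall>w\<in>space S. \<exists>n\<ge>1. measure (kernel_pow S K n w) E > 0))"

definition maximal_irreducibility_measure ::
    "'a measure \<Rightarrow> ('a \<Rightarrow> 'a measure) \<Rightarrow> 'a measure \<Rightarrow> bool" where
  "maximal_irreducibility_measure S K \<psi> \<longleftrightarrow>
     irreducibility_measure S K \<psi> \<and>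
     (\<forall>\<phi>. irreducibility_measure S K \<phi> \<longrightarrow> absolutely_continuous \<psi> \<phi>)"

definition irreducible_kernel :: "'a measure \<Rightarrow> ('a \<Rightarrow> 'a measure) \<Rightarrow> bool" where
  "irreducible_kernel S K \<longleftrightarrow> (\<exists>\<phi>. irreducibility_measure S K \<phi>)"

definition kernel_cycle ::
    "'a measure \<Rightarrow> ('a \<Rightarrow> 'a measure) \<Rightarrow> 'a measure \<Rightarrow> nat \<Rightarrow> (nat \<Rightarrow> 'a set) \<Rightarrow> bool" where
  "kernel_cycle S K \<psi> n D \<longleftrightarrow>
     (\<forall>i<n. D i \<in> sets S) \<and> disjoint_family_on D {..<n} \<and>
     (\<forall>i<n. \<forall>w\<in>D i. measure (K w) (D (Suc i mod n)) = 1) \<and>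
     space S - (\<Union>i<n. D i) \<in> null_sets \<psi>"

definition aperiodic_kernel :: "'a measure \<Rightarrow> ('a \<Rightarrow> 'a measure) \<Rightarrow> bool" where
  "aperiodic_kernel S K \<longleftrightarrow>
     \<not> (\<exists>\<psi> n D. maximal_irreducibility_measure S K \<psi> \<and> n \<ge> 2 \<and> kernel_cycle S K \<psi> n D)"

definition stationary_dist :: "'a measure \<Rightarrow> ('a \<Rightarrow> 'a measure) \<Rightarrow> 'a measure \<Rightarrow> bool" where
  "stationary_dist S K \<nu> \<longleftrightarrow> prob_space \<nu> \<and> sets \<nu> = sets S \<and> Giry_Monad.bind \<nu> K = \<nu>"

definition the_stationary :: "'a measure \<Rightarrow> ('a \<Rightarrow> 'a measure) \<Rightarrow> 'a measure" where
  "the_stationary S K = (THE \<nu>. stationary_dist S K \<nu>)"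


section \<open>Processes\<close>

text \<open>
  \<open>noise k\<close>, \<open>bias k\<close>, \<open>info k\<close>, \<open>state k\<close>, \<open>iter k\<close> stand for
  \<open>M\<^sub>k\<close>, \<open>B\<^sub>k\<close>, \<open>\<chi>\<^sub>k\<close>, \<open>W\<^sub>k\<close>, \<open>\<theta>\<^sub>k\<close>; \<open>noise\<close> and \<open>info\<close> are
  used from index 1 on.  \<open>info k\<close> takes values in the measurable space \<open>info_space k\<close>.
\<close>

record ('w, 'x) sa_process =
  pdim :: nat
  Theta :: "rvec set"
  sdim :: nat
  States :: "rvec set"
  drift :: "rvec \<Rightarrow> rvec \<Rightarrow> rvec"
  kernel :: "rvec \<Rightarrow> rvec \<Rightarrow> rvec measure"
  target :: rvec
  noise_scale :: "nat \<Rightarrow> real"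
  bias_scale :: "nat \<Rightarrow> real"
  Omega :: "'w measure"
  iter :: "nat \<Rightarrow> 'w \<Rightarrow> rvec"
  state :: "nat \<Rightarrow> 'w \<Rightarrow> rvec"
  noise :: "nat \<Rightarrow> 'w \<Rightarrow> rvec"
  bias :: "nat \<Rightarrow> 'w \<Rightarrow> rvec"
  info_space :: "nat \<Rightarrow> 'x measure"
  info :: "nat \<Rightarrow> 'w \<Rightarrow> 'x"

abbreviation state_space :: "('w, 'x) sa_process \<Rightarrow> rvec measure" where
  "state_space p \<equiv> borel_on (States p)"

definition sigma_join :: "'w measure \<Rightarrow> 'w measure \<Rightarrow> 'w measure" where
  "sigma_join A B = sigma (space A) (sets A \<union> sets B)"

definition info_algebra :: "('w, 'x) sa_process \<Rightarrow> nat \<Rightarrow> 'w measure" where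
  "info_algebra p k = vimage_algebra (space (Omega p)) (info p k) (info_space p k)"

primrec Gminus :: "('w, 'x) sa_process \<Rightarrow> nat \<Rightarrow> 'w measure" where
  "Gminus p 0 =
     vimage_algebra (space (Omega p)) (\<lambda>\<omega>. (iter p 0 \<omega>, state p 0 \<omega>))
       (borel_on (Theta p) \<Otimes>\<^sub>M state_space p)"
| "Gminus p (Suc k) =
     sigma_join (sigma_join (Gminus p k) (info_algebra p (Suc k)))
       (vimage_algebra (space (Omega p)) (state p (Suc k)) (state_space p))"

definition Gplus :: "('w, 'x) sa_process \<Rightarrow> nat \<Rightarrow> 'w measure" where
  "Gplus p k = sigma_join (Gminus p k) (info_algebra p (Suc k))"

definition step_size :: "real \<Rightarrow> real \<Rightarrow> nat \<Rightarrow> real" where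
  "step_size \<alpha>0 \<delta> k = (if k = 0 then \<alpha>0 else \<alpha>0 * real k powr (- \<delta>))"

text \<open>
  The set, drift and kernels.  Measurability into \<^const>\<open>prob_algebra\<close> says that every
  \<open>kernel p \<theta> w\<close> is a probability measure on the state space and that
  \<open>(\<theta>, w) \<mapsto> kernel p \<theta> w E\<close> is measurable for every measurable \<open>E\<close>.
\<close>

definition process_data :: "('w, 'x) sa_process \<Rightarrow> bool" where
  "process_data p \<longleftrightarrow>
     0 < pdim p \<and> 0 < sdim p \<and>
     Theta p \<subseteq> Rn (pdim p) \<and>
     States p \<in> sets (borel_on (Rn (sdim p))) \<and>
     (\<lambda>(\<theta>, w). drift p \<theta> w)
       \<in> borel_on (Theta p) \<Otimes>\<^sub>M state_space p \<rightarrow>\<^sub>M borel_on (Rn (pdim p)) \<and>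
     (\<lambda>(\<theta>, w). kernel p \<theta> w)
       \<in> borel_on (Theta p) \<Otimes>\<^sub>M state_space p \<rightarrow>\<^sub>M prob_algebra (state_space p)"

definition extended_recursion :: "real \<Rightarrow> real \<Rightarrow> ('w, 'x) sa_process \<Rightarrow> bool" where
  "extended_recursion \<alpha>0 \<delta> p \<longleftrightarrow>
     prob_space (Omega p) \<and>
     iter p 0 \<in> Omega p \<rightarrow>\<^sub>M borel_on (Theta p) \<and>
     (\<forall>k. state p k \<in> Omega p \<rightarrow>\<^sub>M state_space p) \<and>
     (\<forall>k. noise p (Suc k) \<in> Omega p \<rightarrow>\<^sub>M borel_on (Rn (pdim p))) \<and>
     (\<forall>k. info p (Suc k) \<in> Omega p \<rightarrow>\<^sub>M info_space p (Suc k)) \<and>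
     (\<forall>k. noise p (Suc k) \<in> info_algebra p (Suc k) \<rightarrow>\<^sub>M borel_on (Rn (pdim p))) \<and>
     (\<forall>k. iter p k \<in> Gminus p k \<rightarrow>\<^sub>M borel_on (Rn (pdim p))) \<and>
     (\<forall>k. state p k \<in> Gminus p k \<rightarrow>\<^sub>M state_space p) \<and>
     (\<forall>k. bias p k \<in> Gminus p k \<rightarrow>\<^sub>M borel_on (Rn (pdim p))) \<and>
     (\<forall>k. AE \<omega> in Omega p.
        iter p (Suc k) \<omega> =
          vproj (pdim p) (Theta p)
            (\<lambda>i. iter p k \<omega> i + step_size \<alpha>0 \<delta> k *
                   (drift p (iter p k \<omega>) (state p k \<omega>) i + noise p (Suc k) \<omega> i + bias p k \<omega> i))) \<and>
     (\<forall>k. \<forall>E\<in>sets (state_space p). AE \<omega> in Omega p.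
        real_cond_exp (Omega p) (Gplus p k) (\<lambda>\<omega>'. indicat_real E (state p (Suc k) \<omega>')) \<omega> =
          measure (kernel p (iter p k \<omega>) (state p k \<omega>)) E)"

definition compactness :: "('w, 'x) sa_process \<Rightarrow> bool" where
  "compactness p \<longleftrightarrow>
     Theta p \<noteq> {} \<and> compactin (Euclidean_space (pdim p)) (Theta p) \<and> vconvex (Theta p)"

definition ergodicity ::
    "nat \<Rightarrow> real \<Rightarrow> real \<Rightarrow> real \<Rightarrow> ('w, 'x) sa_process \<Rightarrow> bool" where
  "ergodicity N \<epsilon>0 lam b p \<longleftrightarrow>
     N > 0 \<and> \<epsilon>0 > 0 \<and> 0 \<le> lam \<and> lam < 1 \<and> b \<ge> 0 \<and>
     (\<forall>\<theta>\<in>Theta p. irreducible_kernel (state_space p) (kernel p \<theta>) \<and>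
        aperiodic_kernel (state_space p) (kernel p \<theta>)) \<and>
     (\<exists>W0 \<phi>. W0 \<noteq> {} \<and> W0 \<in> sets (state_space p) \<and>
        prob_space \<phi> \<and> sets \<phi> = sets (state_space p) \<and>
        (\<forall>\<theta>\<in>Theta p. \<forall>w\<in>W0. \<forall>E\<in>sets (state_space p).
           measure (kernel_pow (state_space p) (kernel p \<theta>) N w) E \<ge> \<epsilon>0 * measure \<phi> E) \<and>
        (\<forall>\<theta>\<in>Theta p. \<forall>w\<in>States p.
           (\<integral>\<^sup>+ y. ennreal (U (sdim p) 2 y) \<partial>kernel p \<theta> w)
             \<le> ennreal (lam * U (sdim p) 2 w + b * indicat_real W0 w))) \<and>
     (\<integral>\<^sup>+ \<omega>. ennreal (U (sdim p) 2 (state p 0 \<omega>)) \<partial>Omega p) < \<infinity>"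

definition mean_drift :: "('w, 'x) sa_process \<Rightarrow> rvec \<Rightarrow> rvec" where
  "mean_drift p \<theta> =
     (\<lambda>i. \<integral>w. drift p \<theta> w i \<partial>the_stationary (state_space p) (kernel p \<theta>))"

definition kernel_continuity :: "real \<Rightarrow> ('w, 'x) sa_process \<Rightarrow> bool" where
  "kernel_continuity LP p \<longleftrightarrow>
     LP > 0 \<and>
     (\<forall>\<theta>\<in>Theta p. \<forall>\<theta>'\<in>Theta p. \<forall>w\<in>States p. \<forall>f\<in>borel_measurable (state_space p).
        (\<forall>y\<in>States p. \<bar>f y\<bar> \<le> U (sdim p) 1 y) \<longrightarrow>
        \<bar>(\<integral>y. f y \<partial>kernel p \<theta> w) - (\<integral>y. f y \<partial>kernel p \<theta>' w)\<bar>
          \<le> LP * U (sdim p) 1 w * vdist (pdim p) \<theta> \<theta>')"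

definition growth :: "real \<Rightarrow> real \<Rightarrow> ('w, 'x) sa_process \<Rightarrow> bool" where
  "growth LF CF p \<longleftrightarrow>
     LF > 0 \<and> CF > 0 \<and>
     (\<forall>\<theta>\<in>Theta p. \<forall>\<theta>'\<in>Theta p. \<forall>w\<in>States p.
        vdist (pdim p) (drift p \<theta> w) (drift p \<theta>' w)
          \<le> LF * (1 + vnorm (sdim p) w) * vdist (pdim p) \<theta> \<theta>') \<and>
     (\<forall>\<theta>\<in>Theta p. \<forall>w\<in>States p.
        vnorm (pdim p) (drift p \<theta> w) \<le> CF * (1 + vnorm (sdim p) w))"

definition interior_target :: "('w, 'x) sa_process \<Rightarrow> bool" where
  "interior_target p \<longleftrightarrow>
     target p \<in> Euclidean_space (pdim p) interior_of Theta p \<and>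
     mean_drift p (target p) = (\<lambda>i. 0)"

definition quasi_strong_monotonicity :: "real \<Rightarrow> ('w, 'x) sa_process \<Rightarrow> bool" where
  "quasi_strong_monotonicity \<zeta> p \<longleftrightarrow>
     \<zeta> > 0 \<and>
     (\<forall>\<theta>\<in>Theta p.
        vinner (pdim p) (\<lambda>i. \<theta> i - target p i) (mean_drift p \<theta>)
          \<le> - \<zeta> * (vdist (pdim p) \<theta> (target p))\<^sup>2)"

text \<open>
  \<^const>\<open>real_cond_exp\<close> is the difference of the conditional expectations of the positive and
  the negative part, so it is meaningful under conditional square integrability alone.
\<close>

definition error_condition ::
    "real \<Rightarrow> real \<Rightarrow> real \<Rightarrow> real \<Rightarrow> ('w, 'x) sa_process \<Rightarrow> bool" where
  "error_condition \<omega>M \<omega>B CM CB p \<longleftrightarrow>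
     CM \<ge> 0 \<and> CB \<ge> 0 \<and>
     (\<forall>k. noise p (Suc k) \<in> Gplus p k \<rightarrow>\<^sub>M borel_on (Rn (pdim p)) \<and>
        (AE \<omega> in Omega p.
           nn_cond_exp (Omega p) (Gminus p k)
             (\<lambda>\<omega>'. ennreal ((vnorm (pdim p) (noise p (Suc k) \<omega>'))\<^sup>2)) \<omega> < \<infinity>) \<and>
        (\<forall>i<pdim p. AE \<omega> in Omega p.
           real_cond_exp (Omega p) (Gminus p k) (\<lambda>\<omega>'. noise p (Suc k) \<omega>' i) \<omega> = 0) \<and>
        (AE \<omega> in Omega p.
           nn_cond_exp (Omega p) (Gminus p k)
             (\<lambda>\<omega>'. ennreal ((vnorm (pdim p) (noise p (Suc k) \<omega>'))\<^sup>2)) \<omega>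
             \<le> ennreal ((noise_scale p k)\<^sup>2 * U (sdim p) 2 (state p k \<omega>)))) \<and>
     (\<forall>k. bias p k \<in> Gminus p k \<rightarrow>\<^sub>M borel_on (Rn (pdim p)) \<and>
        (AE \<omega> in Omega p. vnorm (pdim p) (bias p k \<omega>) \<le> bias_scale p k)) \<and>
     (\<forall>k. 0 \<le> noise_scale p k \<and> noise_scale p k \<le> CM * real (k + 1) powr \<omega>M \<and>
        0 \<le> bias_scale p k \<and> bias_scale p k \<le> CB * real (k + 1) powr (- \<omega>B))"

end

theory Submission
  imports Defs
begin

text \<open>
  A single process on the line attains the exponent \<open>s - 1\<close> with
  \<open>s = 2 (\<delta> - \<beta> - \<omega>\<^sub>M) > 1\<close>, which is at least as strong as the exponent
  \<open>s - 1 + \<epsilon>\<close> for every \<open>\<epsilon> > 0\<close>.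

  All difficulty is put into the martingale noise.  The state chain sits at one point, the bias
  vanishes, and the drift is \<open>-\<theta> / \<alpha>\<^sub>0\<close> on \<open>\<Theta> = [-2c, 2c]\<close>, with target 0; the
  slope \<open>\<zeta> = 1 / \<alpha>\<^sub>0\<close> gives \<open>2 \<zeta> \<alpha>\<^sub>0 = 2 > 1\<close> and makes the deterministic part of the
  update at \<open>k \<ge> 1\<close> the contraction by the factor \<open>1 - k\<^sup>-\<^sup>\<delta> \<in> [0, 1]\<close>.  The noise added in step \<open>k\<close> is rare
  but large: independently of the past it equals \<open>\<plusminus>x\<^sub>k\<close> with probability \<open>p\<^sub>k / 2\<close> each and
  0 otherwise.  The size \<open>x\<^sub>k\<close>, of order \<open>k\<close> to the power \<open>\<delta> - \<beta>\<close>, is chosen such that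
  \<open>\<alpha>\<^sub>k x\<^sub>k\<close> is three times the radius \<open>c k\<^sup>-\<^sup>\<beta>\<close> of the forbidden tube, and
  \<open>p\<^sub>k = k\<^sup>-\<^sup>s\<close> is then the largest probability, up to a constant, that the variance bound
  allows (\<open>variance_scale\<close>).

  A jump at time \<open>k\<close> throws every iterate that is inside the tube out of it
  (\<open>jump_escapes\<close>).  So whenever some jump occurs at a time \<open>k \<ge> k\<^sub>0\<close>, the iterates leave the
  tube at time \<open>k\<close> or \<open>k + 1\<close>, whatever happened before.  Jumps at different times
  are independent, and the \<open>k\<^sub>0\<close> trials with \<open>k\<^sub>0 \<le> k < 2 k\<^sub>0\<close> have success probability at
  least \<open>(2 k\<^sub>0)\<^sup>-\<^sup>s\<close> each, so one of them succeeds with probability of order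
  \<open>k\<^sub>0 \<cdot> k\<^sub>0\<^sup>-\<^sup>s\<close> (\<open>jump_probability\<close>).

  The sample space is the product of the noise laws.  Every sigma-algebra of the filtration is
  contained in the one generated by finitely many coordinates (\<open>sets_filtration_past\<close>), and
  conditional expectations of functions of the remaining coordinates are constants
  (\<open>nn_cond_exp_future\<close>).  This yields the moment conditions on the noise, and it turns the
  probability of a late jump into a conditional one (\<open>conditional_exceedance\<close>).
\<close>

section \<open>Conditioning an independent sequence on its past\<close>

definition trial_space :: "(nat \<Rightarrow> 'a pmf) \<Rightarrow> (nat \<Rightarrow> 'a) measure" where
  "trial_space q = PiM UNIV (\<lambda>i. measure_pmf (q i))"

definition past :: "(nat \<Rightarrow> 'a pmf) \<Rightarrow> nat \<Rightarrow> (nat \<Rightarrow> 'a) measure" where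
  "past q n = vimage_algebra UNIV (\<lambda>\<omega>. restrict \<omega> {..n}) (PiM {..n} (\<lambda>i. measure_pmf (q i)))"

lemma space_trial_space [simp]: "space (trial_space q) = UNIV"
  by (simp add: trial_space_def space_PiM)

lemma prob_space_trial_space: "prob_space (trial_space q)"
  unfolding trial_space_def by (intro prob_space_PiM prob_space_measure_pmf)

lemma measurable_coordinate:
  assumes "i \<in> I" and "f \<in> UNIV \<rightarrow> space N"
  shows "(\<lambda>\<omega>. f (\<omega> i)) \<in> PiM I (\<lambda>i. measure_pmf (q i)) \<rightarrow>\<^sub>M N"
proof -
  have "f \<in> measure_pmf (q i) \<rightarrow>\<^sub>M N"
    using assms(2) by simp
  then show ?thesis
    using measurable_component_singleton[OF assms(1), of "\<lambda>i. measure_pmf (q i)"] by measurable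
qed

lemma measurable_trial:
  "f \<in> UNIV \<rightarrow> space N \<Longrightarrow> (\<lambda>\<omega>. f (\<omega> i)) \<in> trial_space q \<rightarrow>\<^sub>M N"
  unfolding trial_space_def by (rule measurable_coordinate) auto

lemma nn_integral_trial:
  "(\<integral>\<^sup>+ \<omega>. f (\<omega> i) \<partial>trial_space q) = (\<integral>\<^sup>+ y. f y \<partial>measure_pmf (q i))"
proof -
  have "(\<integral>\<^sup>+ y. f y \<partial>distr (trial_space q) (measure_pmf (q i)) (\<lambda>\<omega>. \<omega> i)) = (\<integral>\<^sup>+ \<omega>. f (\<omega> i) \<partial>trial_space q)"
    by (rule nn_integral_distr) (auto intro: measurable_trial[where f = "\<lambda>x. x"])
  then show ?thesis
    unfolding trial_space_def
    by (subst (asm) distr_PiM_component) (auto intro: prob_space_measure_pmf)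
qed

lemma AE_trial: "AE \<omega> in trial_space q. \<omega> i \<in> set_pmf (q i)"
  unfolding trial_space_def
  by (rule AE_PiM_component) (auto intro: prob_space_measure_pmf AE_measure_pmf)

text \<open>
  The coordinates of a product measure are independent because the identity has the product of the
  coordinate laws as its joint distribution; grouping coordinates into disjoint blocks preserves
  independence.
\<close>

lemma indep_past_future:
  "prob_space.indep_var (trial_space q)
     (PiM {..n} (\<lambda>i. measure_pmf (q i))) (\<lambda>\<omega>. restrict \<omega> {..n})
     (PiM {n<..} (\<lambda>i. measure_pmf (q i))) (\<lambda>\<omega>. restrict \<omega> {n<..})"
proof -
  interpret prob_space "trial_space q" by (rule prob_space_trial_space)
  let ?\<mu> = "\<lambda>i. measure_pmf (q i)"
  have rv: "random_variable (?\<mu> i) (\<lambda>\<omega>. \<omega> i)" for i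
    by (rule measurable_trial[where f = "\<lambda>x. x"]) auto
  have "distr (trial_space q) (PiM UNIV ?\<mu>) (\<lambda>x. \<lambda>i\<in>UNIV. x i) = trial_space q"
    unfolding trial_space_def restrict_UNIV by (rule distr_id)
  also have "\<dots> = PiM UNIV (\<lambda>i. distr (trial_space q) (?\<mu> i) (\<lambda>\<omega>. \<omega> i))"
    unfolding trial_space_def
    by (rule PiM_cong) (auto intro!: distr_PiM_component[symmetric] prob_space_measure_pmf)
  finally have "indep_vars ?\<mu> (\<lambda>i \<omega>. \<omega> i) UNIV"
    using rv by (subst indep_vars_iff_distr_eq_PiM') auto
  then show ?thesis
    by (rule indep_var_restrict) auto
qed

lemma subalgebra_past: "subalgebra (trial_space q) (past q n)"
proof -
  have "(\<lambda>\<omega>. restrict \<omega> {..n}) \<in> trial_space q \<rightarrow>\<^sub>M PiM {..n} (\<lambda>i. measure_pmf (q i))"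
    unfolding trial_space_def by (rule measurable_restrict_subset) auto
  then show ?thesis
    unfolding subalgebra_def past_def
    using sets_image_in_sets[of "trial_space q" UNIV] by auto
qed

lemma measurable_past:
  assumes "i \<le> n" and "f \<in> UNIV \<rightarrow> space N"
  shows "(\<lambda>\<omega>. f (\<omega> i)) \<in> past q n \<rightarrow>\<^sub>M N"
proof -
  have 1: "(\<lambda>\<omega>. restrict \<omega> {..n}) \<in> past q n \<rightarrow>\<^sub>M PiM {..n} (\<lambda>i. measure_pmf (q i))"
    unfolding past_def by (rule measurable_vimage_algebra1) (auto simp: space_PiM)
  have 2: "(\<lambda>\<omega>. f (\<omega> i)) \<in> PiM {..n} (\<lambda>i. measure_pmf (q i)) \<rightarrow>\<^sub>M N"
    using assms by (intro measurable_coordinate) auto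
  show ?thesis
    using measurable_compose[OF 1 2] assms(1) by simp
qed

text \<open>
  Independence turns \<open>\<integral>\<^sup>+ x\<in>A. f x \<partial>M\<close> into \<open>M A\<close> times the mean of \<open>f\<close>, which is the
  integral over \<open>A\<close> of that constant; these integrals characterise the conditional expectation.
\<close>

lemma nn_cond_exp_indep:
  fixes f :: "'a \<Rightarrow> ennreal"
  assumes "prob_space M" and sub: "subalgebra M F"
    and indep: "\<And>A. A \<in> sets F \<Longrightarrow> prob_space.indep_var M borel (indicator A :: 'a \<Rightarrow> ennreal) borel f"
  shows "AE x in M. nn_cond_exp M F f x = (\<integral>\<^sup>+ y. f y \<partial>M)"
proof -
  interpret prob_space M by fact
  interpret finite_measure_subalgebra M F
    by unfold_locales (rule sub)
  have f: "f \<in> borel_measurable M"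
    using indep_var_rv2[OF indep[OF sets.empty_sets]] .
  have "(\<integral>\<^sup>+x\<in>A. f x \<partial>M) = (\<integral>\<^sup>+x\<in>A. (\<integral>\<^sup>+ y. f y \<partial>M) \<partial>M)" if A: "A \<in> sets F" for A
  proof -
    have [measurable]: "A \<in> sets M"
      using A sub by (auto simp: subalgebra_def)
    define X where "X = case_bool (indicator A :: 'a \<Rightarrow> ennreal) f"
    have "(\<lambda>_. borel) = (case_bool borel borel :: bool \<Rightarrow> ennreal measure)"
      by (auto simp: fun_eq_iff split: bool.split)
    then have iv: "indep_vars (\<lambda>_. borel) X UNIV"
      using indep[OF A] by (simp add: indep_var_def X_def)
    have "(\<integral>\<^sup>+x. (\<Prod>i\<in>UNIV. X i x) \<partial>M) = (\<Prod>i\<in>UNIV. \<integral>\<^sup>+x. X i x \<partial>M)"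
      by (rule indep_vars_nn_integral[OF _ iv]) auto
    then have "(\<integral>\<^sup>+x\<in>A. f x \<partial>M) = (\<integral>\<^sup>+ y. f y \<partial>M) * emeasure M A"
      by (simp add: UNIV_bool X_def mult.commute)
    then show ?thesis
      by (simp add: nn_integral_cmult_indicator)
  qed
  then have "AE x in M. (\<integral>\<^sup>+ y. f y \<partial>M) = nn_cond_exp M F f x"
    by (intro nn_cond_exp_charact) (auto simp: f)
  then show ?thesis by auto
qed

text \<open>
  The sigma-algebra \<open>F\<close> need not be generated by coordinates: it is enough that its
  events depend only on the coordinates up to \<open>n\<close>.  This is how the filtration of a process enters, since the
  iterates are functions of the noise so far.
\<close>

lemma nn_cond_exp_future:
  fixes g :: "(nat \<Rightarrow> 'a) \<Rightarrow> ennreal"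
  assumes sp: "space F = UNIV" and sets: "sets F \<subseteq> sets (past q n)"
    and g: "g \<in> borel_measurable (PiM {n<..} (\<lambda>i. measure_pmf (q i)))"
  shows "AE \<omega> in trial_space q. nn_cond_exp (trial_space q) F (\<lambda>\<omega>. g (restrict \<omega> {n<..})) \<omega>
           = (\<integral>\<^sup>+ \<omega>. g (restrict \<omega> {n<..}) \<partial>trial_space q)"
proof (rule nn_cond_exp_indep[OF prob_space_trial_space])
  interpret prob_space "trial_space q" by (rule prob_space_trial_space)
  show "subalgebra (trial_space q) F"
    using sp sets subalgebra_past[of q n] by (auto simp: subalgebra_def)
  fix A assume "A \<in> sets F"
  then have "A \<in> sets (past q n)" using sets by auto
  then obtain B where B: "B \<in> sets (PiM {..n} (\<lambda>i. measure_pmf (q i)))"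
      and A: "A = (\<lambda>\<omega>. restrict \<omega> {..n}) -` B \<inter> UNIV"
    unfolding past_def by (subst (asm) sets_vimage_algebra2) (auto simp: space_PiM)
  have "indep_var borel ((indicator B :: _ \<Rightarrow> ennreal) \<circ> (\<lambda>\<omega>. restrict \<omega> {..n}))
          borel (g \<circ> (\<lambda>\<omega>. restrict \<omega> {n<..}))"
    using B by (intro indep_var_compose[OF indep_past_future] g) auto
  moreover have "(indicator B :: _ \<Rightarrow> ennreal) \<circ> (\<lambda>\<omega>. restrict \<omega> {..n}) = indicator A"
    by (auto simp: A fun_eq_iff indicator_def)
  ultimately show "indep_var borel (indicator A :: _ \<Rightarrow> ennreal) borel (\<lambda>\<omega>. g (restrict \<omega> {n<..}))"
    by (simp add: o_def)
qed

lemma real_cond_exp_future: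
  fixes g :: "(nat \<Rightarrow> 'a) \<Rightarrow> real"
  assumes "space F = UNIV" and "sets F \<subseteq> sets (past q n)"
    and g [measurable]: "g \<in> borel_measurable (PiM {n<..} (\<lambda>i. measure_pmf (q i)))"
  shows "AE \<omega> in trial_space q. real_cond_exp (trial_space q) F (\<lambda>\<omega>. g (restrict \<omega> {n<..})) \<omega>
           = enn2real (\<integral>\<^sup>+ \<omega>. ennreal (g (restrict \<omega> {n<..})) \<partial>trial_space q)
             - enn2real (\<integral>\<^sup>+ \<omega>. ennreal (- g (restrict \<omega> {n<..})) \<partial>trial_space q)"
  using nn_cond_exp_future[OF assms(1,2), of "\<lambda>x. ennreal (g x)"]
    nn_cond_exp_future[OF assms(1,2), of "\<lambda>x. ennreal (- g x)"]
  by (auto simp: real_cond_exp_def)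

text \<open>
  Unlike in the previous two lemmas, the function is given on a single coordinate, and the constant is an
  integral against the law of that coordinate.
\<close>

lemma nn_cond_exp_next_trial:
  fixes f :: "'a \<Rightarrow> ennreal"
  assumes "space F = UNIV" and "sets F \<subseteq> sets (past q n)" and "n < m"
  shows "AE \<omega> in trial_space q. nn_cond_exp (trial_space q) F (\<lambda>\<omega>. f (\<omega> m)) \<omega>
           = (\<integral>\<^sup>+ y. f y \<partial>measure_pmf (q m))"
proof -
  have "(\<lambda>\<omega>. f (\<omega> m)) \<in> borel_measurable (PiM {n<..} (\<lambda>i. measure_pmf (q i)))"
    using assms(3) by (intro measurable_coordinate) auto
  from nn_cond_exp_future[OF assms(1,2) this] show ?thesis
    using assms(3) by (simp add: nn_integral_trial)
qed

section \<open>Euclidean spaces of dimension one\<close>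

definition on_line :: "real \<Rightarrow> rvec" where
  "on_line r = (\<lambda>i. if i = 0 then r else 0)"

lemma on_line_0 [simp]: "on_line r 0 = r"
  by (simp add: on_line_def)

lemma Rn_1: "Rn 1 = range on_line"
  unfolding topspace_Euclidean_space
proof (intro equalityI subsetI)
  fix x :: rvec assume "x \<in> {x. \<forall>i\<ge>1. x i = 0}"
  then have "x = on_line (x 0)" by (auto simp: on_line_def fun_eq_iff)
  then show "x \<in> range on_line" by blast
qed (auto simp: on_line_def)

lemma vnorm_1 [simp]: "vnorm (Suc 0) x = \<bar>x 0\<bar>"
  by (simp add: vnorm_def L2_set_def lessThan_Suc)

lemma vdist_1 [simp]: "vdist (Suc 0) x y = \<bar>x 0 - y 0\<bar>"
  by (simp add: vdist_def)

lemma continuous_on_on_line: "continuous_on S on_line"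
proof (rule continuous_on_coordinatewise_then_product)
  show "continuous_on S (\<lambda>r. on_line r i)" for i
    by (cases "i = 0") (auto simp: on_line_def intro: continuous_intros)
qed

lemma measurable_on_line:
  assumes "f \<in> borel_measurable M" and "\<And>x. x \<in> space M \<Longrightarrow> f x \<in> I"
  shows "(\<lambda>x. on_line (f x)) \<in> M \<rightarrow>\<^sub>M borel_on (on_line ` I)"
proof (rule measurable_restrict_space2)
  show "(\<lambda>x. on_line (f x)) \<in> borel_measurable M"
    using assms(1) by (intro measurable_coordinatewise_then_product) (simp add: on_line_def)
qed (use assms(2) in auto)

text \<open>
  The minimiser of the distance is unique, so the choice operator inside \<^const>\<open>vproj\<close> can only
  select the clamped value.
\<close>

lemma vproj_interval:
  fixes R :: real
  assumes "0 \<le> R"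
  shows "vproj 1 (on_line ` {-R..R}) (on_line y) = on_line (max (-R) (min R y))"
proof -
  let ?S = "on_line ` {-R..R}" and ?p = "on_line (max (-R) (min R y))"
  have p: "?p \<in> ?S" using assms by auto
  have min: "\<bar>y - max (-R) (min R y)\<bar> \<le> \<bar>y - u\<bar>" if "u \<in> {-R..R}" for u
    using that by (auto simp: min_def max_def)
  have uniq: "u = max (-R) (min R y)" if "u \<in> {-R..R}" "\<bar>y - u\<bar> \<le> \<bar>y - max (-R) (min R y)\<bar>" for u
    using that by (auto simp: min_def max_def split: if_splits)
  have "is_arg_min (vdist 1 (on_line y)) (\<lambda>x. x \<in> ?S) = (\<lambda>x. x = ?p)"
  proof (rule ext, rule iffI)
    fix x
    assume x: "is_arg_min (vdist 1 (on_line y)) (\<lambda>x. x \<in> ?S) x"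
    then obtain u where u: "u \<in> {-R..R}" "x = on_line u" by (auto simp: is_arg_min_def)
    have "\<bar>y - u\<bar> \<le> \<bar>y - max (-R) (min R y)\<bar>"
    proof -
      have "vdist 1 (on_line y) x \<le> vdist 1 (on_line y) ?p"
        using x p unfolding is_arg_min_linorder by blast
      then show ?thesis by (simp add: u(2))
    qed
    then show "x = ?p" using uniq u by blast
  next
    fix x
    assume "x = ?p"
    then show "is_arg_min (vdist 1 (on_line y)) (\<lambda>x. x \<in> ?S) x"
      using p min by (auto simp: is_arg_min_linorder)
  qed
  then show ?thesis
    by (simp only: vproj_def arg_min_on_def arg_min_def some_eq_trivial)
qed

lemma compactin_interval: "compactin (Euclidean_space 1) (on_line ` {-R..R})"
proof -
  have "compact (on_line ` {-R..R})"
    by (intro compact_continuous_image continuous_on_on_line) auto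
  moreover have "on_line ` {-R..R} \<subseteq> {x. \<forall>i\<ge>1. x i = 0}"
    by (auto simp: on_line_def)
  ultimately show ?thesis
    by (simp add: Euclidean_space_def compactin_subtopology euclidean_product_topology)
qed

lemma zero_in_interior_interval:
  assumes "0 < R"
  shows "on_line 0 \<in> Euclidean_space 1 interior_of (on_line ` {-R..R})"
proof -
  have "open ((\<lambda>x :: rvec. x 0) -` {-R<..<R})"
    by (intro open_vimage continuous_on_product_coordinates) auto
  then have "openin (Euclidean_space 1) ((\<lambda>x. x 0) -` {-R<..<R} \<inter> {x. \<forall>i\<ge>1. x i = 0})"
    unfolding Euclidean_space_def openin_subtopology euclidean_product_topology by auto
  moreover have "(\<lambda>x. x 0) -` {-R<..<R} \<inter> {x. \<forall>i\<ge>1. x i = 0} \<subseteq> on_line ` {-R..R}"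
  proof
    fix x assume x: "x \<in> (\<lambda>x :: rvec. x 0) -` {-R<..<R} \<inter> {x. \<forall>i\<ge>1. x i = 0}"
    then have "x = on_line (x 0)" by (auto simp: on_line_def fun_eq_iff)
    then show "x \<in> on_line ` {-R..R}" using x by (intro image_eqI[of _ _ "x 0"]) auto
  qed
  ultimately show ?thesis
    unfolding interior_of_def using assms by (force simp: on_line_def)
qed

section \<open>The chain on a one-point state space\<close>

lemma sets_borel_on_singleton: "sets (borel_on {z}) = {{}, {z}}"
proof -
  have "sets (borel_on {z}) = (\<inter>) {z} ` sets borel"
    by (rule sets_restrict_space)
  also have "\<dots> = {{}, {z}}"
  proof (intro equalityI subsetI)
    fix A assume "A \<in> {{}, {z}}"
    moreover have "{} = {z} \<inter> {}" "{z} = {z} \<inter> UNIV" by auto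
    ultimately show "A \<in> (\<inter>) {z} ` sets borel"
      by (metis image_eqI insert_iff sets.empty_sets sets.top singletonD space_borel)
  qed auto
  finally show ?thesis .
qed

text \<open>
  A point carries only one kernel, the constant one; the locale names it and its state space in
  order to collect the facts that the ergodicity condition asks for.
\<close>

locale point_chain =
  fixes z :: rvec and S :: "rvec measure" and K :: "rvec \<Rightarrow> rvec measure"
  defines "S \<equiv> borel_on {z}" and "K \<equiv> \<lambda>_. return S z"
begin

lemma space_S: "space S = {z}"
  by (simp add: S_def space_restrict_space)

lemma sets_S: "sets S = {{}, {z}}"
  by (simp add: S_def sets_borel_on_singleton)

lemma measure_point: "E \<in> sets S \<Longrightarrow> measure (return S z) E = indicator E z"
  by (rule measure_return)

lemma K_kernel: "K \<in> S \<rightarrow>\<^sub>M subprob_algebra S"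
  unfolding K_def
  by (rule measurable_const) (auto simp: space_subprob_algebra space_S intro!: prob_space_imp_subprob_space prob_space_return)

lemma kernel_pow_point: "kernel_pow S K n z = return S z"
proof (induction n)
  case (Suc n)
  then show ?case
    using bind_return[OF K_kernel, of z] by (simp add: space_S K_def)
qed simp

lemma prob_space_point: "prob_space (return S z)"
  by (intro prob_space_return) (simp add: space_S)

lemma stationary_point: "stationary_dist S K \<nu> \<longleftrightarrow> \<nu> = return S z"
proof
  assume "stationary_dist S K \<nu>"
  then interpret prob_space \<nu> by (simp add: stationary_dist_def)
  have sets: "sets \<nu> = sets S"
    using \<open>stationary_dist S K \<nu>\<close> by (simp add: stationary_dist_def)
  then have "space \<nu> = {z}" using sets_eq_imp_space_eq space_S by blast
  then have "emeasure \<nu> {z} = 1" using emeasure_space_1 by simp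
  then show "\<nu> = return S z"
    using sets by (intro measure_eqI) (auto simp: sets_S)
next
  assume "\<nu> = return S z"
  then show "stationary_dist S K \<nu>"
    using bind_return[OF K_kernel, of z] prob_space_point
    by (simp add: stationary_dist_def space_S K_def)
qed

lemma the_stationary_point: "the_stationary S K = return S z"
  unfolding the_stationary_def by (rule the_equality) (auto simp: stationary_point)

lemma irreducible_point: "irreducible_kernel S K"
proof -
  interpret prob_space "return S z" by (rule prob_space_point)
  have "irreducibility_measure S K (return S z)"
    unfolding irreducibility_measure_def
  proof (intro conjI ballI impI)
    show "sigma_finite_measure (return S z)" by unfold_locales
    fix E w assume "E \<in> sets S" "0 < emeasure (return S z) E" "w \<in> space S"
    then show "\<exists>n\<ge>1. 0 < measure (kernel_pow S K n w) E"
      using measure_point[of E]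
      by (intro exI[of _ 1]) (auto simp: space_S kernel_pow_point sets_S simp del: kernel_pow.simps)
  qed (use emeasure_space_1 in auto)
  then show ?thesis unfolding irreducible_kernel_def by blast
qed

text \<open>
  A nonzero measure on a single point charges that point, so some class of a cycle contains \<open>z\<close>.
  The next class must contain it too, which contradicts disjointness once there are two classes.
\<close>

lemma aperiodic_point: "aperiodic_kernel S K"
  unfolding aperiodic_kernel_def
proof (intro notI, elim exE conjE)
  fix \<psi> n D
  assume max: "maximal_irreducibility_measure S K \<psi>" and n: "(2 :: nat) \<le> n"
    and cyc: "kernel_cycle S K \<psi> n D"
  have \<psi>: "sets \<psi> = sets S" "emeasure \<psi> (space \<psi>) \<noteq> 0"
    using max by (auto simp: maximal_irreducibility_measure_def irreducibility_measure_def)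
  have D: "D i \<in> sets S" if "i < n" for i
    using cyc that by (auto simp: kernel_cycle_def)
  have "space S - (\<Union>i<n. D i) \<noteq> space S"
    using cyc \<psi> sets_eq_imp_space_eq[OF \<psi>(1)] by (auto simp: kernel_cycle_def null_sets_def)
  then obtain i where i: "i < n" "z \<in> D i"
    by (auto simp: space_S)
  define j where "j = Suc i mod n"
  \<comment> \<open>The successor class is a different one because the length of the cycle is at least 2.\<close>
  have j: "j < n" "j \<noteq> i"
    using n i(1) by (auto simp: j_def mod_Suc)
  have "measure (K z) (D j) = 1"
    using cyc i by (auto simp: kernel_cycle_def j_def)
  then have "z \<in> D j"
    using measure_point[OF D[OF j(1)]] by (auto simp: K_def indicator_def split: if_splits)
  moreover have "D i \<inter> D j = {}"
    using cyc i j by (auto simp: kernel_cycle_def disjoint_family_on_def)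
  ultimately show False using i by auto
qed

end

section \<open>Joins of sigma-algebras\<close>

lemma space_sigma_join [simp]: "space (sigma_join A B) = space A"
  by (simp add: sigma_join_def space_measure_of_conv)

lemma sigma_join_least:
  assumes "space A = space N" and "sets A \<subseteq> sets N" and "sets B \<subseteq> sets N"
  shows "sets (sigma_join A B) \<subseteq> sets N"
proof -
  have "sets A \<union> sets B \<subseteq> Pow (space A)"
    using assms sets.space_closed[of N] by auto
  then have "sets (sigma_join A B) = sigma_sets (space A) (sets A \<union> sets B)"
    by (simp add: sigma_join_def sets_measure_of)
  also have "\<dots> \<subseteq> sets N"
    unfolding assms(1) using assms by (intro sets.sigma_sets_subset) auto
  finally show ?thesis .
qed

lemma subalgebra_sigma_join:
  assumes "space B = space A"
  shows "subalgebra (sigma_join A B) A" and "subalgebra (sigma_join A B) B"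
proof -
  have "sets A \<union> sets B \<subseteq> Pow (space A)"
    using assms sets.space_closed[of A] sets.space_closed[of B] by auto
  then have "sets (sigma_join A B) = sigma_sets (space A) (sets A \<union> sets B)"
    by (simp add: sigma_join_def sets_measure_of)
  then show "subalgebra (sigma_join A B) A" "subalgebra (sigma_join A B) B"
    using assms by (auto simp: subalgebra_def intro: sigma_sets.Basic)
qed

section \<open>Symmetric jumps\<close>

definition jump_law :: "real \<Rightarrow> real \<Rightarrow> real pmf" where
  "jump_law x p = bind_pmf (bernoulli_pmf p)
     (\<lambda>b. if b then map_pmf (\<lambda>s. if s then x else - x) (bernoulli_pmf (1 / 2)) else return_pmf 0)"

lemma set_jump_law: "set_pmf (jump_law x p) \<subseteq> {0, x, - x}"
  by (auto simp: jump_law_def split: if_splits)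

lemma nn_integral_jump_law:
  fixes f :: "real \<Rightarrow> ennreal"
  assumes "0 \<le> p" "p \<le> 1"
  shows "(\<integral>\<^sup>+ y. f y \<partial>jump_law x p)
    = (f x * ennreal (1 / 2) + f (- x) * ennreal (1 / 2)) * ennreal p + f 0 * ennreal (1 - p)"
proof -
  have "(\<integral>\<^sup>+ y. f y \<partial>map_pmf (\<lambda>s. if s then x else - x) (bernoulli_pmf (1 / 2)))
      = f x * ennreal (1 / 2) + f (- x) * ennreal (1 / 2)"
    by (simp add: nn_integral_bernoulli_pmf del: ennreal_half)
  then show ?thesis
    using assms by (simp add: jump_law_def nn_integral_bind_pmf nn_integral_bernoulli_pmf del: nn_integral_map_pmf)
qed

text \<open>
  The positive and the negative part have the same, finite or infinite, integral.  In this form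
  the vanishing mean fits \<^const>\<open>real_cond_exp\<close>, which is a difference of two such integrals.
\<close>

lemma jump_law_mean:
  assumes "0 \<le> p" "p \<le> 1"
  shows "(\<integral>\<^sup>+ y. ennreal y \<partial>jump_law x p) = (\<integral>\<^sup>+ y. ennreal (- y) \<partial>jump_law x p)"
  using assms by (simp add: nn_integral_jump_law add.commute)

lemma jump_law_second_moment:
  assumes "0 \<le> p" "p \<le> 1"
  shows "(\<integral>\<^sup>+ y. ennreal (y\<^sup>2) \<partial>jump_law x p) = ennreal (x\<^sup>2 * p)"
proof -
  have "ennreal (x\<^sup>2) * ennreal (1 / 2) = ennreal (x\<^sup>2 / 2)"
    by (simp add: ennreal_mult[symmetric] del: ennreal_half)
  then have "ennreal (x\<^sup>2) * ennreal (1 / 2) + ennreal (x\<^sup>2) * ennreal (1 / 2) = ennreal (x\<^sup>2)"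
    by (simp flip: ennreal_plus del: ennreal_half)
  then show ?thesis
    using assms by (subst nn_integral_jump_law) (simp_all add: ennreal_mult del: ennreal_half)
qed

lemma jump_law_no_jump:
  assumes "0 \<le> p" "p \<le> 1" "x \<noteq> 0"
  shows "emeasure (measure_pmf (jump_law x p)) {0} = ennreal (1 - p)"
proof -
  have "emeasure (measure_pmf (jump_law x p)) {0} = (\<integral>\<^sup>+ y. indicator {0} y \<partial>jump_law x p)"
    by simp
  also have "\<dots> = ennreal (1 - p)"
    using assms by (subst nn_integral_jump_law) auto
  finally show ?thesis .
qed

text \<open>
  In \<open>n\<close> independent trials with success probability \<open>p\<close>, at least one success is at least half as
  likely as the union bound \<open>n p\<close> suggests, as long as that bound does not exceed 1.  With
  \<open>y = n p\<close> this is the chain \<open>(1 - p)\<^sup>n \<le> exp (- y) \<le> 1 / (1 + y) \<le> 1 - y / 2\<close>.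
\<close>

lemma at_least_one_lower_bound:
  fixes p :: real
  assumes "0 \<le> p" "p \<le> 1" "real n * p \<le> 1"
  shows "real n * p / 2 \<le> 1 - (1 - p) ^ n"
proof -
  define y where "y = real n * p"
  have y: "0 \<le> y" "y \<le> 1" using assms by (auto simp: y_def)
  have "(1 - p) ^ n \<le> exp (- p) ^ n"
    using assms exp_ge_add_one_self[of "- p"] by (intro power_mono) auto
  also have "\<dots> = exp (- y)"
    by (simp add: y_def exp_of_nat_mult[symmetric])
  also have "\<dots> \<le> 1 / (1 + y)"
    using y exp_ge_add_one_self[of y] by (simp add: exp_minus field_simps)
  also have "\<dots> \<le> 1 - y / 2"
  proof -
    have "y * y \<le> y" using y mult_left_le[of y y] by simp
    then show ?thesis using y by (simp add: field_simps)
  qed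
  finally show ?thesis by (simp add: y_def)
qed

section \<open>A process with rare large jumps\<close>

locale rare_jumps =
  fixes \<alpha>0 \<delta> \<omega>M \<beta> c :: real
  assumes \<delta>: "1 / 2 < \<delta>" "\<delta> \<le> 1" and \<alpha>0: "\<alpha>0 > 0" and \<omega>M: "0 \<le> \<omega>M"
    and \<beta>: "0 \<le> \<beta>" "\<beta> < \<delta> - \<omega>M - 1 / 2" and c: "c > 0"
begin

text \<open>
  Multiplied with the step size, a jump displaces the iterate by \<open>3 c k\<^sup>-\<^sup>\<beta>\<close>.  The value at
  \<open>k = 0\<close> is 0, so the initial step has no noise.
\<close>

definition jump :: "nat \<Rightarrow> real" where
  "jump k = 3 * c / \<alpha>0 * real k powr (\<delta> - \<beta>)"

text \<open>
  The largest power of \<open>k\<close> for which jumps of this size have variance of order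
  \<open>k\<close> to the power \<open>2 \<omega>\<^sub>M\<close>.
\<close>

definition rate :: "nat \<Rightarrow> real" where
  "rate k = real k powr (- (2 * (\<delta> - \<beta> - \<omega>M)))"

text \<open>
  Coordinate \<open>k + 1\<close> carries the noise of step \<open>k\<close>.  Coordinate 0 is not a noise variable; the
  truncated subtraction gives it some law.
\<close>

definition laws :: "nat \<Rightarrow> real pmf" where
  "laws i = jump_law (jump (i - 1)) (rate (i - 1))"

text \<open>
  The scalar recursion for the iterates, with the projection onto \<open>[-2c, 2c]\<close> written as a clamp.
\<close>

primrec pos :: "nat \<Rightarrow> (nat \<Rightarrow> real) \<Rightarrow> real" where
  "pos 0 \<omega> = 0"
| "pos (Suc k) \<omega> = max (- (2 * c))
     (min (2 * c) (pos k \<omega> + step_size \<alpha>0 \<delta> k * (- pos k \<omega> / \<alpha>0 + \<omega> (Suc k))))"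

definition proc :: "(nat \<Rightarrow> real, nat \<Rightarrow> real) sa_process" where
  "proc =
     \<lparr>pdim = 1, Theta = on_line ` {- (2 * c)..2 * c}, sdim = 1, States = {on_line 0},
      drift = (\<lambda>\<theta> w. on_line (- \<theta> 0 / \<alpha>0)),
      kernel = (\<lambda>\<theta> w. return (borel_on {on_line 0}) (on_line 0)),
      target = on_line 0,
      noise_scale = (\<lambda>k. 3 * c / \<alpha>0 * real k powr \<omega>M), bias_scale = (\<lambda>k. 0),
      Omega = trial_space laws,
      iter = (\<lambda>k \<omega>. on_line (pos k \<omega>)), state = (\<lambda>k \<omega>. on_line 0),
      noise = (\<lambda>k \<omega>. on_line (\<omega> k)), bias = (\<lambda>k \<omega>. on_line 0),
      info_space = (\<lambda>k. borel), info = (\<lambda>k \<omega>. on_line (\<omega> k))\<rparr>"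

lemma proc_sel [simp]:
  "pdim proc = Suc 0" "Theta proc = on_line ` {- (2 * c)..2 * c}" "sdim proc = Suc 0"
  "States proc = {on_line 0}" "drift proc = (\<lambda>\<theta> w. on_line (- \<theta> 0 / \<alpha>0))"
  "kernel proc = (\<lambda>\<theta> w. return (borel_on {on_line 0}) (on_line 0))" "target proc = on_line 0"
  "noise_scale proc = (\<lambda>k. 3 * c / \<alpha>0 * real k powr \<omega>M)" "bias_scale proc = (\<lambda>k. 0)"
  "Omega proc = trial_space laws" "iter proc = (\<lambda>k \<omega>. on_line (pos k \<omega>))"
  "state proc = (\<lambda>k \<omega>. on_line 0)" "noise proc = (\<lambda>k \<omega>. on_line (\<omega> k))"
  "bias proc = (\<lambda>k \<omega>. on_line 0)" "info_space proc = (\<lambda>k. borel)"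
  "info proc = (\<lambda>k \<omega>. on_line (\<omega> k))"
  by (simp_all add: proc_def)

sublocale point_chain "on_line 0" "borel_on {on_line 0}" "\<lambda>_. return (borel_on {on_line 0}) (on_line 0)"
  by unfold_locales simp_all

lemma rate_bounds: "0 \<le> rate k" "rate k \<le> 1"
proof -
  show "0 \<le> rate k" by (simp add: rate_def)
  show "rate k \<le> 1"
    using \<beta> powr_mono[of "- (2 * (\<delta> - \<beta> - \<omega>M))" 0 "real k"]
    by (cases "k = 0") (auto simp: rate_def)
qed

lemma measurable_on_line_Rn:
  "f \<in> borel_measurable M \<Longrightarrow> (\<lambda>x. on_line (f x)) \<in> M \<rightarrow>\<^sub>M borel_on (Rn (Suc 0))"
  using measurable_on_line[of f M UNIV] Rn_1 by simp

lemma measurable_borel_on_line: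
  "f \<in> borel_measurable M \<Longrightarrow> (\<lambda>x. on_line (f x)) \<in> borel_measurable M"
  using measurable_on_line_Rn measurable_restrict_space2_iff by blast

section \<open>The process satisfies all conditions\<close>

lemma process_data: "process_data proc"
  unfolding process_data_def
proof (intro conjI)
  show "Theta proc \<subseteq> Rn (pdim proc)"
    using Rn_1 by auto
  have "{on_line 0} = Rn (Suc 0) \<inter> {on_line 0}" using Rn_1 by auto
  moreover have "{on_line 0} \<in> sets borel" by simp
  ultimately show "States proc \<in> sets (borel_on (Rn (sdim proc)))"
    unfolding sets_restrict_space proc_sel by (rule image_eqI)
  have "(\<lambda>x. fst x 0) \<in> borel_measurable (borel_on (on_line ` {- (2 * c)..2 * c}) \<Otimes>\<^sub>M borel_on {on_line 0})"
    by (rule measurable_compose[OF measurable_fst])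
      (auto intro: measurable_restrict_space1 measurable_product_coordinates)
  then have "(\<lambda>x. - fst x 0 / \<alpha>0) \<in> borel_measurable (borel_on (on_line ` {- (2 * c)..2 * c}) \<Otimes>\<^sub>M borel_on {on_line 0})"
    by measurable
  from measurable_on_line_Rn[OF this]
  show "(\<lambda>(\<theta>, w). drift proc \<theta> w)
       \<in> borel_on (Theta proc) \<Otimes>\<^sub>M state_space proc \<rightarrow>\<^sub>M borel_on (Rn (pdim proc))"
    by (simp add: case_prod_unfold)
  have "return (borel_on {on_line 0}) (on_line 0) \<in> space (prob_algebra (borel_on {on_line 0}))"
    using prob_space_point by (simp add: space_prob_algebra)
  then show "(\<lambda>(\<theta>, w). kernel proc \<theta> w)
       \<in> borel_on (Theta proc) \<Otimes>\<^sub>M state_space proc \<rightarrow>\<^sub>M prob_algebra (state_space proc)"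
    by (simp add: case_prod_unfold)
qed auto

lemma measurable_trial_info:
  "(\<lambda>\<omega>. \<omega> k) \<in> borel_measurable (info_algebra proc k)"
proof -
  have "(\<lambda>\<omega>. on_line (\<omega> k)) \<in> info_algebra proc k \<rightarrow>\<^sub>M borel"
    unfolding info_algebra_def proc_sel by (rule measurable_vimage_algebra1) auto
  from measurable_compose[OF this measurable_product_coordinates, of 0]
  show ?thesis by simp
qed

lemma space_Gminus [simp]: "space (Gminus proc k) = UNIV"
  by (induction k) auto

lemma space_info_algebra [simp]: "space (info_algebra proc k) = UNIV"
  by (simp add: info_algebra_def)

lemma space_Gplus [simp]: "space (Gplus proc k) = UNIV"
  by (simp add: Gplus_def)

lemma subalgebra_Gplus:
  "subalgebra (Gplus proc k) (Gminus proc k)" "subalgebra (Gplus proc k) (info_algebra proc (Suc k))"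
  "subalgebra (Gminus proc (Suc k)) (Gplus proc k)"
proof -
  show "subalgebra (Gplus proc k) (Gminus proc k)"
    "subalgebra (Gplus proc k) (info_algebra proc (Suc k))"
    unfolding Gplus_def by (rule subalgebra_sigma_join; simp)+
  show "subalgebra (Gminus proc (Suc k)) (Gplus proc k)"
    unfolding Gplus_def Gminus.simps by (rule subalgebra_sigma_join) simp
qed

lemma sets_info_past: "k \<le> n \<Longrightarrow> sets (info_algebra proc k) \<subseteq> sets (past laws n)"
  unfolding info_algebra_def proc_sel
  using subalgebra_past[of laws n]
  by (intro sets_image_in_sets measurable_past) (auto simp: subalgebra_def)

text \<open>
  Besides the constant state and initial iterate, only the noise variables generate the filtration,
  and those revealed by time \<open>k\<close> are coordinates up to \<open>k\<close> (up to \<open>k + 1\<close> once the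
  information of update \<open>k\<close> is included).
\<close>

lemma sets_filtration_past:
  "sets (Gminus proc k) \<subseteq> sets (past laws k)" "sets (Gplus proc k) \<subseteq> sets (past laws (Suc k))"
proof -
  have sp: "space (past laws n) = UNIV" for n
    by (simp add: past_def)
  have plus: "sets (Gplus proc k) \<subseteq> sets (past laws (Suc k))"
    if "sets (Gminus proc k) \<subseteq> sets (past laws (Suc k))" for k
    unfolding Gplus_def using that sets_info_past by (intro sigma_join_least) (auto simp: sp)
  have minus: "sets (Gminus proc k) \<subseteq> sets (past laws n)" if "k \<le> n" for k n
    using that
  proof (induction k)
    case 0
    have "(\<lambda>\<omega>. (on_line 0, on_line 0))
       \<in> past laws n \<rightarrow>\<^sub>M borel_on (on_line ` {- (2 * c)..2 * c}) \<Otimes>\<^sub>M borel_on {on_line 0}"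
      using c by (intro measurable_const) (auto simp: space_pair_measure space_restrict_space)
    then show ?case
      by (simp add: sets_image_in_sets sp)
  next
    case (Suc k)
    have "sets (sigma_join (Gminus proc k) (info_algebra proc (Suc k))) \<subseteq> sets (past laws n)"
      using Suc sets_info_past by (intro sigma_join_least) (auto simp: sp)
    moreover have "sets (vimage_algebra UNIV (\<lambda>\<omega> :: nat \<Rightarrow> real. on_line 0) (borel_on {on_line 0})) \<subseteq> sets (past laws n)"
      by (intro sets_image_in_sets measurable_const) (auto simp: sp space_restrict_space)
    ultimately show ?case
      unfolding Gminus.simps proc_sel space_trial_space
      by (intro sigma_join_least[of _ _ "vimage_algebra _ _ _"]) (simp_all add: sp)
  qed
  show "sets (Gminus proc k) \<subseteq> sets (past laws k)" by (rule minus) simp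
  show "sets (Gplus proc k) \<subseteq> sets (past laws (Suc k))" by (intro plus minus) simp
qed

lemma subalgebra_filtration:
  "subalgebra (trial_space laws) (Gminus proc k)" "subalgebra (trial_space laws) (Gplus proc k)"
  using sets_filtration_past[of k] subalgebra_past[of laws k] subalgebra_past[of laws "Suc k"]
  by (auto simp: subalgebra_def simp del: Gminus.simps)

lemma measurable_pos: "pos k \<in> borel_measurable (Gminus proc k)"
proof (induction k)
  case (Suc k)
  have [measurable]: "pos k \<in> borel_measurable (Gminus proc (Suc k))"
    "(\<lambda>\<omega>. \<omega> (Suc k)) \<in> borel_measurable (Gminus proc (Suc k))"
    using Suc measurable_trial_info[of "Suc k"] subalgebra_Gplus[of k]
    by (meson measurable_from_subalg)+
  show ?case unfolding pos.simps by measurable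
qed (simp del: Gminus.simps)

text \<open>
  The clamped scalar recursion is the projected recursion, for every outcome.
\<close>

lemma pos_step:
  "on_line (pos (Suc k) \<omega>) =
     vproj (pdim proc) (Theta proc)
       (\<lambda>i. iter proc k \<omega> i + step_size \<alpha>0 \<delta> k *
          (drift proc (iter proc k \<omega>) (state proc k \<omega>) i + noise proc (Suc k) \<omega> i + bias proc k \<omega> i))"
proof -
  have "(\<lambda>i. iter proc k \<omega> i + step_size \<alpha>0 \<delta> k *
          (drift proc (iter proc k \<omega>) (state proc k \<omega>) i + noise proc (Suc k) \<omega> i + bias proc k \<omega> i))
      = on_line (pos k \<omega> + step_size \<alpha>0 \<delta> k * (- pos k \<omega> / \<alpha>0 + \<omega> (Suc k)))"
    by (auto simp: on_line_def)
  then show ?thesis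
    using c vproj_interval[of "2 * c"] by simp
qed

lemma extended_recursion: "extended_recursion \<alpha>0 \<delta> proc"
proof -
  interpret prob_space "trial_space laws" by (rule prob_space_trial_space)
  have [measurable]: "(\<lambda>\<omega>. \<omega> k) \<in> borel_measurable (trial_space laws)" for k
    by (rule measurable_trial[where f = "\<lambda>x. x"]) auto
  have cond: "AE \<omega> in trial_space laws.
        real_cond_exp (trial_space laws) (Gplus proc k) (\<lambda>\<omega>'. indicat_real E (on_line 0)) \<omega> =
          measure (return (borel_on {on_line 0}) (on_line 0)) E"
    if "E \<in> sets (borel_on {on_line 0})" for k E
  proof -
    interpret finite_measure_subalgebra "trial_space laws" "Gplus proc k"
      by unfold_locales (rule subalgebra_filtration)
    show ?thesis
      unfolding measure_point[OF that] by (rule real_cond_exp_F_meas) auto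
  qed
  have noise: "(\<lambda>\<omega>. on_line (\<omega> k)) \<in> info_algebra proc k \<rightarrow>\<^sub>M borel_on (Rn (Suc 0))" for k
    by (intro measurable_on_line_Rn measurable_trial_info)
  have point: "(\<lambda>\<omega>. on_line 0) \<in> M \<rightarrow>\<^sub>M borel_on {on_line 0}" for M :: "(nat \<Rightarrow> real) measure"
    by (intro measurable_const) (simp add: space_restrict_space)
  show ?thesis
    unfolding extended_recursion_def proc_sel
    using c cond noise point prob_space_axioms
    by (auto simp del: Gminus.simps pos.simps(2) simp: pos_step[simplified proc_sel]
        intro!: measurable_on_line_Rn measurable_borel_on_line measurable_pos measurable_on_line)
qed

lemma compactness: "compactness proc"
proof -
  have "vconvex (on_line ` {- (2 * c)..2 * c})"
    unfolding vconvex_def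
  proof safe
    fix x y u :: real assume "x \<in> {- (2 * c)..2 * c}" "y \<in> {- (2 * c)..2 * c}" "0 \<le> u" "u \<le> 1"
    then have "(1 - u) *\<^sub>R x + u *\<^sub>R y \<in> {- (2 * c)..2 * c}"
      by (intro convexD) auto
    moreover have "(\<lambda>i. (1 - u) * on_line x i + u * on_line y i) = on_line ((1 - u) * x + u * y)"
      by (auto simp: on_line_def)
    ultimately show "(\<lambda>i. (1 - u) * on_line x i + u * on_line y i) \<in> on_line ` {- (2 * c)..2 * c}"
      by simp
  qed
  then show ?thesis
    using c compactin_interval by (auto simp: compactness_def)
qed

lemma ergodicity: "ergodicity 1 1 0 1 proc"
proof -
  have "measure (return (borel_on {on_line 0}) (on_line 0)) E
      \<le> measure (kernel_pow (borel_on {on_line 0}) (\<lambda>_. return (borel_on {on_line 0}) (on_line 0)) 1 (on_line 0)) E" for E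
    by (simp add: kernel_pow_point del: kernel_pow.simps)
  moreover have "(\<integral>\<^sup>+ y. ennreal (U (Suc 0) 2 y) \<partial>return (borel_on {on_line 0}) (on_line 0)) = 1"
    by (subst nn_integral_return) (auto simp: U_def space_S sets_S measurable_def)
  ultimately show ?thesis
    using prob_space_point irreducible_point aperiodic_point prob_space.emeasure_space_1[OF prob_space_trial_space[of laws]]
    unfolding ergodicity_def
    by (auto simp: sets_S U_def intro!: exI[of _ "{on_line 0}"] exI[of _ "return (borel_on {on_line 0}) (on_line 0)"] simp del: kernel_pow.simps One_nat_def)
qed

lemma kernel_continuity: "kernel_continuity 1 proc"
  by (auto simp: kernel_continuity_def U_def)

lemma growth: "growth (1 / \<alpha>0) (2 * c / \<alpha>0) proc"
  using \<alpha>0 c by (auto simp: growth_def abs_if field_simps split: if_splits)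

text \<open>
  The stationary distribution is the point mass, so averaging does not change the drift.
\<close>

lemma mean_drift_proc: "mean_drift proc \<theta> = on_line (- \<theta> 0 / \<alpha>0)"
proof
  interpret prob_space "return (borel_on {on_line 0}) (on_line 0)" by (rule prob_space_point)
  show "mean_drift proc \<theta> i = on_line (- \<theta> 0 / \<alpha>0) i" for i
    unfolding mean_drift_def proc_sel the_stationary_point using prob_space by simp
qed

lemma interior_target: "interior_target proc"
  using c zero_in_interior_interval[of "2 * c"]
  by (auto simp: interior_target_def mean_drift_proc on_line_def)

lemma quasi_strong_monotonicity: "quasi_strong_monotonicity (1 / \<alpha>0) proc"
  using \<alpha>0 by (auto simp: quasi_strong_monotonicity_def mean_drift_proc vinner_def power2_eq_square)

text \<open>
  The calibration of \<open>rate\<close> against \<open>jump\<close>: the exponents \<open>2 (\<delta> - \<beta>)\<close> and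
  \<open>- 2 (\<delta> - \<beta> - \<omega>\<^sub>M)\<close> add up to \<open>2 \<omega>\<^sub>M\<close>.
\<close>

lemma variance_scale: "(jump k)\<^sup>2 * rate k = (3 * c / \<alpha>0 * real k powr \<omega>M)\<^sup>2"
proof (cases "k = 0")
  case False
  then have "(real k powr (\<delta> - \<beta>))\<^sup>2 * rate k = (real k powr \<omega>M)\<^sup>2"
    by (simp add: rate_def power2_eq_square powr_add[symmetric] algebra_simps)
  then have "(3 * c / \<alpha>0)\<^sup>2 * ((real k powr (\<delta> - \<beta>))\<^sup>2 * rate k) = (3 * c / \<alpha>0)\<^sup>2 * (real k powr \<omega>M)\<^sup>2"
    by simp
  then show ?thesis
    unfolding jump_def power_mult_distrib by (simp only: mult.assoc)
qed (simp add: jump_def)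

lemma error_condition: "error_condition \<omega>M \<omega>B (3 * c / \<alpha>0) 0 proc"
proof -
  have noise: "(\<lambda>\<omega>. on_line (\<omega> (Suc k))) \<in> Gplus proc k \<rightarrow>\<^sub>M borel_on (Rn (Suc 0))" for k
    using measurable_from_subalg[OF subalgebra_Gplus(2) measurable_trial_info]
    by (rule measurable_on_line_Rn)
  have sq: "AE \<omega> in trial_space laws.
      nn_cond_exp (trial_space laws) (Gminus proc k) (\<lambda>\<omega>'. ennreal ((\<omega>' (Suc k))\<^sup>2)) \<omega>
        = ennreal ((3 * c / \<alpha>0 * real k powr \<omega>M)\<^sup>2)" for k
    using nn_cond_exp_next_trial[OF space_Gminus sets_filtration_past(1), of k "Suc k" "\<lambda>y. ennreal (y\<^sup>2)"]
    by (simp add: laws_def jump_law_second_moment rate_bounds variance_scale)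
  have mean: "AE \<omega> in trial_space laws.
      real_cond_exp (trial_space laws) (Gminus proc k) (\<lambda>\<omega>'. \<omega>' (Suc k)) \<omega> = 0" for k
    using nn_cond_exp_next_trial[OF space_Gminus sets_filtration_past(1), of k "Suc k" ennreal]
      nn_cond_exp_next_trial[OF space_Gminus sets_filtration_past(1), of k "Suc k" "\<lambda>y. ennreal (- y)"]
    by (auto simp: real_cond_exp_def laws_def jump_law_mean rate_bounds)
  have scale: "real k powr \<omega>M \<le> (1 + real k) powr \<omega>M" for k
    using \<omega>M by (intro powr_mono2) auto
  show ?thesis
    unfolding error_condition_def
  proof (intro conjI allI impI)
    fix k
    show "AE \<omega> in Omega proc. nn_cond_exp (Omega proc) (Gminus proc k)
        (\<lambda>\<omega>'. ennreal ((vnorm (pdim proc) (noise proc (Suc k) \<omega>'))\<^sup>2)) \<omega> < \<infinity>"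
      unfolding proc_sel using sq[of k] by (auto elim!: eventually_mono)
    show "AE \<omega> in Omega proc. nn_cond_exp (Omega proc) (Gminus proc k)
        (\<lambda>\<omega>'. ennreal ((vnorm (pdim proc) (noise proc (Suc k) \<omega>'))\<^sup>2)) \<omega>
        \<le> ennreal ((noise_scale proc k)\<^sup>2 * U (sdim proc) 2 (state proc k \<omega>))"
      unfolding proc_sel using sq[of k] by (auto simp: U_def elim!: eventually_mono)
    show "noise_scale proc k \<le> 3 * c / \<alpha>0 * real (k + 1) powr \<omega>M"
      using scale[of k] c \<alpha>0 by (simp add: divide_right_mono)
    fix i assume "i < pdim proc"
    then show "AE \<omega> in Omega proc. real_cond_exp (Omega proc) (Gminus proc k)
        (\<lambda>\<omega>'. noise proc (Suc k) \<omega>' i) \<omega> = 0"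
      unfolding proc_sel using mean[of k] by simp
  qed (use noise c \<alpha>0 in \<open>auto intro!: measurable_on_line_Rn\<close>)
qed

section \<open>Late jumps force late exceedances\<close>

text \<open>
  From inside the tube the contraction leaves the iterate within \<open>c k\<^sup>-\<^sup>\<beta>\<close> of the target, and the
  jump moves it by \<open>3 c k\<^sup>-\<^sup>\<beta>\<close>, so it lands at distance at least \<open>2 c k\<^sup>-\<^sup>\<beta>\<close> whatever the
  sign of the jump.  The projection only cuts distances down to \<open>2 c\<close>, which still lies outside
  the tube.
\<close>

lemma jump_escapes:
  assumes k: "1 \<le> k" and near: "\<bar>pos k \<omega>\<bar> \<le> c * real k powr (- \<beta>)"
    and jump: "\<bar>\<omega> (Suc k)\<bar> = jump k"
  shows "\<bar>pos (Suc k) \<omega>\<bar> > c * real (Suc k) powr (- \<beta>)"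
proof -
  define a where "a = real k powr (- \<delta>)"
  define u where "u = real k powr (- \<beta>)"
  define v where "v = real (Suc k) powr (- \<beta>)"
  define y where "y = \<alpha>0 * a * \<omega> (Suc k)"
  have a: "0 \<le> a" "a \<le> 1"
    using k \<delta> powr_mono[of "- \<delta>" 0 "real k"] by (auto simp: a_def)
  have u: "u \<le> 1"
    using k \<beta> powr_mono[of "- \<beta>" 0 "real k"] by (auto simp: u_def)
  have v: "0 < v" "v \<le> u"
    using k \<beta> by (auto simp: v_def u_def intro!: powr_mono2')
  have "a * real k powr (\<delta> - \<beta>) = u"
    using k by (simp add: a_def u_def powr_add[symmetric])
  then have "\<bar>y\<bar> = 3 * c * u"
    using \<alpha>0 a jump by (simp add: y_def abs_mult jump_def)
  moreover have "\<bar>(1 - a) * pos k \<omega>\<bar> \<le> 1 * (c * u)"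
    unfolding abs_mult using a near c v by (intro mult_mono) (auto simp: u_def)
  moreover have "c * u \<le> c" "0 < c * v" "c * v \<le> c * u"
    using c u v by auto
  ultimately have "c * v < \<bar>max (- (2 * c)) (min (2 * c) ((1 - a) * pos k \<omega> + y))\<bar>"
    by linarith
  moreover have "pos (Suc k) \<omega> = max (- (2 * c)) (min (2 * c) ((1 - a) * pos k \<omega> + y))"
    using k \<alpha>0 by (simp add: step_size_def a_def y_def algebra_simps)
  ultimately show ?thesis
    by (simp only: v_def)
qed

text \<open>
  There are \<open>k\<^sub>0\<close> trials in the window, and the smallest success probability among them exceeds
  \<open>(2 k\<^sub>0)\<^sup>-\<^sup>s\<close>.  On a window of this length the rates stay comparable to the first one, and
  their sum over the window already has the order of the whole tail sum.
\<close>

lemma jump_probability: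
  assumes "1 \<le> k0"
  shows "2 powr (- (2 * (\<delta> - \<beta> - \<omega>M)) - 1) * real k0 powr (- (2 * (\<delta> - \<beta> - \<omega>M) - 1))
    \<le> measure (trial_space laws) {\<omega>. \<exists>i\<in>{Suc k0..2 * k0}. \<omega> i \<noteq> 0}"
proof -
  define s where "s = 2 * (\<delta> - \<beta> - \<omega>M)"
  have s: "1 < s" using \<beta> by (simp add: s_def)
  interpret prob_space "trial_space laws" by (rule prob_space_trial_space)
  interpret P: product_prob_space "\<lambda>i. measure_pmf (laws i)" UNIV
    by unfold_locales
  define Q where "Q = {\<omega> :: nat \<Rightarrow> real. \<forall>i\<in>{Suc k0..2 * k0}. \<omega> i \<in> {0}}"
  define p where "p = (2 * real k0) powr (- s)"
  have p: "0 \<le> p" "p \<le> 1"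
    using assms s powr_mono[of "- s" 0 "2 * real k0"] by (auto simp: p_def)
  have kp: "real k0 * p = 2 powr (- s) * real k0 powr (- (s - 1))"
    using assms by (simp add: p_def powr_mult powr_diff powr_minus field_simps)
  have "2 powr (- s) * real k0 powr (- (s - 1)) \<le> 1 * 1"
    using assms s powr_mono[of "- s" 0 "2 :: real"] powr_mono[of "- (s - 1)" 0 "real k0"]
    by (intro mult_mono) auto
  then have kp1: "real k0 * p \<le> 1" by (simp add: kp)
  have Qset: "Q \<in> sets (trial_space laws)"
  proof -
    have [measurable]: "(\<lambda>\<omega>. \<omega> i \<in> {0}) \<in> trial_space laws \<rightarrow>\<^sub>M count_space UNIV" for i
      by (rule measurable_trial) auto
    have "{\<omega> \<in> space (trial_space laws). \<forall>i\<in>{Suc k0..2 * k0}. \<omega> i \<in> {0}} \<in> sets (trial_space laws)"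
      by measurable
    then show ?thesis by (simp add: Q_def)
  qed
  have "emeasure (trial_space laws) Q = (\<Prod>i\<in>{Suc k0..2 * k0}. emeasure (measure_pmf (laws i)) {0})"
    using P.emeasure_PiM_Collect[of "{Suc k0..2 * k0}" "\<lambda>_. {0}"]
    by (simp add: trial_space_def Q_def space_PiM)
  also have "\<dots> = (\<Prod>i\<in>{Suc k0..2 * k0}. ennreal (1 - rate (i - 1)))"
    using assms \<alpha>0 c
    by (intro prod.cong refl) (auto simp: laws_def jump_def intro!: jump_law_no_jump rate_bounds)
  also have "\<dots> = ennreal (\<Prod>i\<in>{Suc k0..2 * k0}. 1 - rate (i - 1))"
    by (intro prod_ennreal) (simp add: rate_bounds)
  finally have "prob Q = (\<Prod>i\<in>{Suc k0..2 * k0}. 1 - rate (i - 1))"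
    by (simp add: measure_def prod_nonneg rate_bounds)
  also have "\<dots> \<le> (\<Prod>i\<in>{Suc k0..2 * k0}. 1 - p)"
  proof (intro prod_mono conjI)
    fix i assume i: "i \<in> {Suc k0..2 * k0}"
    have "p \<le> real (i - 1) powr (- s)"
      unfolding p_def using i assms s by (intro powr_mono2') auto
    then show "1 - rate (i - 1) \<le> 1 - p" by (simp add: rate_def s_def)
  qed (simp add: rate_bounds)
  also have "\<dots> = (1 - p) ^ k0" by simp
  finally have "real k0 * p / 2 \<le> 1 - prob Q"
    using at_least_one_lower_bound[OF p kp1] by simp
  also have "\<dots> = prob (UNIV - Q)"
    using prob_compl[OF Qset] by simp
  also have "UNIV - Q = {\<omega>. \<exists>i\<in>{Suc k0..2 * k0}. \<omega> i \<noteq> 0}"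
    by (auto simp: Q_def)
  also have "real k0 * p / 2 = 2 powr (- s - 1) * real k0 powr (- (s - 1))"
    by (simp add: kp powr_diff)
  finally show ?thesis by (simp add: s_def)
qed

text \<open>
  The exceedance event contains the event of a jump in the window, up to a null set on which some
  coordinate takes a value outside the support of its law.  The window involves only coordinates
  from \<open>k\<^sub>0 + 1 \<ge> 2\<close> on, whereas the conditioning sigma-algebra only knows coordinates up to 1,
  so the conditional probability of a jump is the unconditional one.
\<close>

lemma conditional_exceedance:
  assumes "1 \<le> k0"
  shows "AE \<omega> in trial_space laws. real_cond_exp (trial_space laws) (Gplus proc 0)
      (indicat_real {\<omega>. \<exists>k\<ge>k0. \<bar>pos k \<omega>\<bar> > c * real k powr (- \<beta>)}) \<omega>
    \<ge> 2 powr (- (2 * (\<delta> - \<beta> - \<omega>M)) - 1) * real k0 powr (- (2 * (\<delta> - \<beta> - \<omega>M) - 1))"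
proof -
  interpret prob_space "trial_space laws" by (rule prob_space_trial_space)
  interpret finite_measure_subalgebra "trial_space laws" "Gplus proc 0"
    by unfold_locales (rule subalgebra_filtration)
  define A where "A = {\<omega>. \<exists>k\<ge>k0. \<bar>pos k \<omega>\<bar> > c * real k powr (- \<beta>)}"
  define J where "J = {\<omega> :: nat \<Rightarrow> real. \<exists>i\<in>{Suc k0..2 * k0}. \<omega> i \<noteq> 0}"
  have [measurable]: "pos k \<in> borel_measurable (trial_space laws)" for k
    using measurable_from_subalg[OF subalgebra_filtration(1) measurable_pos] .
  have "{\<omega> \<in> space (trial_space laws). \<exists>k\<ge>k0. \<bar>pos k \<omega>\<bar> > c * real k powr (- \<beta>)} \<in> sets (trial_space laws)"
    by measurable
  then have A [measurable]: "A \<in> sets (trial_space laws)" by (simp add: A_def)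
  define g where "g = (\<lambda>\<omega> :: nat \<Rightarrow> real. of_bool (\<exists>i\<in>{Suc k0..2 * k0}. \<omega> i \<noteq> 0) :: real)"
  have g: "g \<in> borel_measurable (PiM {1<..} (\<lambda>i. measure_pmf (laws i)))"
  proof -
    have [measurable]: "(\<lambda>\<omega>. \<omega> i \<noteq> 0) \<in> PiM {1<..} (\<lambda>i. measure_pmf (laws i)) \<rightarrow>\<^sub>M count_space UNIV"
      if "i \<in> {Suc k0..2 * k0}" for i
      using that assms by (intro measurable_coordinate) auto
    show ?thesis unfolding g_def by measurable
  qed
  have gJ: "g (restrict \<omega> {1<..}) = indicat_real J \<omega>" for \<omega>
    using assms by (auto simp: g_def J_def indicator_def)
  have J [measurable]: "J \<in> sets (trial_space laws)"
  proof -
    have [measurable]: "(\<lambda>\<omega>. \<omega> i \<noteq> 0) \<in> trial_space laws \<rightarrow>\<^sub>M count_space UNIV" for i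
      by (rule measurable_trial) auto
    have "{\<omega> \<in> space (trial_space laws). \<exists>i\<in>{Suc k0..2 * k0}. \<omega> i \<noteq> 0} \<in> sets (trial_space laws)"
      by measurable
    then show ?thesis by (simp add: J_def)
  qed
  have condJ: "AE \<omega> in trial_space laws. real_cond_exp (trial_space laws) (Gplus proc 0) (indicat_real J) \<omega> = prob J"
  proof -
    have "(\<integral>\<^sup>+ \<omega>. ennreal (indicat_real J \<omega>) \<partial>trial_space laws) = emeasure (trial_space laws) J"
      using J by (simp add: ennreal_indicator)
    moreover have "ennreal (- indicat_real J \<omega>) = 0" for \<omega>
      by (simp add: ennreal_neg)
    ultimately show ?thesis
      using real_cond_exp_future[OF space_Gplus sets_filtration_past(2)[of 0, unfolded One_nat_def[symmetric]] g, unfolded gJ]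
      by (simp add: measure_def)
  qed
  \<comment> \<open>Almost surely every nonzero coordinate is a jump of full size.\<close>
  have "AE \<omega> in trial_space laws. \<forall>i. \<omega> i \<in> set_pmf (laws i)"
    by (simp add: AE_all_countable AE_trial)
  then have "AE \<omega> in trial_space laws. indicat_real J \<omega> \<le> indicat_real A \<omega>"
  proof (rule AE_mp, intro AE_I2 impI)
    fix \<omega> assume *: "\<forall>i. \<omega> i \<in> set_pmf (laws i)"
    have "\<omega> \<in> A" if in_J: "\<omega> \<in> J"
    proof -
      obtain i where i: "i \<in> {Suc k0..2 * k0}" "\<omega> i \<noteq> 0"
        using in_J unfolding J_def by blast
      define k where "k = i - 1"
      have k: "k0 \<le> k" "1 \<le> k" "i = Suc k" using i assms by (auto simp: k_def)
      have "0 \<le> jump k" using c \<alpha>0 by (simp add: jump_def)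
      then have size: "\<bar>\<omega> (Suc k)\<bar> = jump k"
        using *[rule_format, of i] i k set_jump_law[of "jump k" "rate k"] by (auto simp: laws_def)
      have "\<bar>pos k \<omega>\<bar> > c * real k powr (- \<beta>) \<or> \<bar>pos (Suc k) \<omega>\<bar> > c * real (Suc k) powr (- \<beta>)"
        using jump_escapes[of k \<omega>] k(2) size by (meson not_le)
      then show ?thesis
        using k(1) le_SucI[OF k(1)] unfolding A_def by blast
    qed
    then show "indicat_real J \<omega> \<le> indicat_real A \<omega>" by (auto simp: indicator_def)
  qed
  then have "AE \<omega> in trial_space laws. real_cond_exp (trial_space laws) (Gplus proc 0) (indicat_real J) \<omega>
      \<le> real_cond_exp (trial_space laws) (Gplus proc 0) (indicat_real A) \<omega>"
    by (rule real_cond_exp_mono) (use A J in \<open>auto intro!: integrable_real_indicator simp: emeasure_eq_measure\<close>)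
  with condJ have "AE \<omega> in trial_space laws. prob J \<le> real_cond_exp (trial_space laws) (Gplus proc 0) (indicat_real A) \<omega>"
    by eventually_elim simp
  then show ?thesis
    using jump_probability[OF assms] unfolding A_def J_def
    by (auto elim!: eventually_mono intro: order_trans)
qed

end

theorem theorem4:
  fixes \<delta> \<alpha>0 \<omega>M \<omega>B \<beta> c :: real
  assumes "1 / 2 < \<delta>" and "\<delta> \<le> 1"
    and "\<alpha>0 > 0"
    and "0 \<le> \<omega>M" and "\<omega>M < \<delta> - 1 / 2"
    and "\<omega>B > 0"
    and "0 \<le> \<beta>" and "\<beta> < min \<omega>B (\<delta> - \<omega>M - 1 / 2)"
    and "c > 0"
  shows "\<exists>(\<C> :: (nat \<Rightarrow> real, nat \<Rightarrow> real) sa_process set)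
           (N :: nat) (\<epsilon>0 :: real) (lam :: real) (b :: real) (LP :: real) (LF :: real) (CF :: real)
           (\<zeta> :: real) (CM :: real) (CB :: real).
         (\<forall>p\<in>\<C>. process_data p \<and> extended_recursion \<alpha>0 \<delta> p \<and> compactness p \<and>
            ergodicity N \<epsilon>0 lam b p \<and> kernel_continuity LP p \<and> growth LF CF p \<and>
            interior_target p \<and> quasi_strong_monotonicity \<zeta> p \<and>
            error_condition \<omega>M \<omega>B CM CB p \<and> (\<delta> = 1 \<longrightarrow> 2 * \<zeta> * \<alpha>0 > 1)) \<and>
         (\<forall>\<epsilon>>0. \<exists>p\<in>\<C>. \<exists>C>0. \<exists>K>0. \<forall>k0 :: nat. real k0 \<ge> K \<longrightarrow>
            (AE \<omega> in Omega p.
               real_cond_exp (Omega p) (Gplus p 0)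
                 (indicat_real {\<omega>' \<in> space (Omega p). \<exists>k\<ge>k0.
                    vdist (pdim p) (iter p k \<omega>') (target p) > c * real k powr (- \<beta>)}) \<omega>
               \<ge> C * real k0 powr (- (2 * (\<delta> - \<beta> - \<omega>M) - 1 + \<epsilon>))))"
proof -
  interpret rare_jumps \<alpha>0 \<delta> \<omega>M \<beta> c
    using assms by unfold_locales auto
  define C where "C = (2 :: real) powr (- (2 * (\<delta> - \<beta> - \<omega>M)) - 1)"
  have "AE \<omega> in Omega proc.
      real_cond_exp (Omega proc) (Gplus proc 0)
        (indicat_real {\<omega>' \<in> space (Omega proc). \<exists>k\<ge>k0.
           vdist (pdim proc) (iter proc k \<omega>') (target proc) > c * real k powr (- \<beta>)}) \<omega>
      \<ge> C * real k0 powr (- (2 * (\<delta> - \<beta> - \<omega>M) - 1 + \<epsilon>))"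
    if "0 < \<epsilon>" "1 \<le> real k0" for \<epsilon> and k0 :: nat
  proof -
    have "C * real k0 powr (- (2 * (\<delta> - \<beta> - \<omega>M) - 1 + \<epsilon>))
        \<le> C * real k0 powr (- (2 * (\<delta> - \<beta> - \<omega>M) - 1))"
      using that by (intro mult_left_mono powr_mono) (auto simp: C_def)
    moreover have "1 \<le> k0" using that by simp
    note conditional_exceedance[OF this, folded C_def]
    ultimately have "AE \<omega> in trial_space laws. C * real k0 powr (- (2 * (\<delta> - \<beta> - \<omega>M) - 1 + \<epsilon>))
        \<le> real_cond_exp (trial_space laws) (Gplus proc 0)
             (indicat_real {\<omega>. \<exists>k\<ge>k0. \<bar>pos k \<omega>\<bar> > c * real k powr (- \<beta>)}) \<omega>"
      by (auto elim!: eventually_mono intro: order_trans)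
    then show ?thesis
      unfolding proc_sel by simp
  qed
  note bound = this
  have tail: "\<exists>C>0. \<exists>K>0. \<forall>k0 :: nat. real k0 \<ge> K \<longrightarrow>
      (AE \<omega> in Omega proc.
         real_cond_exp (Omega proc) (Gplus proc 0)
           (indicat_real {\<omega>' \<in> space (Omega proc). \<exists>k\<ge>k0.
              vdist (pdim proc) (iter proc k \<omega>') (target proc) > c * real k powr (- \<beta>)}) \<omega>
         \<ge> C * real k0 powr (- (2 * (\<delta> - \<beta> - \<omega>M) - 1 + \<epsilon>)))" if "0 < \<epsilon>" for \<epsilon>
  proof (rule exI[of _ C], intro conjI exI[of _ "1 :: real"] allI impI)
    show "0 < C" by (simp add: C_def)
  qed (use bound[OF that] in auto)
  have conditions: "process_data p \<and> extended_recursion \<alpha>0 \<delta> p \<and> compactness p \<and>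
      ergodicity 1 1 0 1 p \<and> kernel_continuity 1 p \<and> growth (1 / \<alpha>0) (2 * c / \<alpha>0) p \<and>
      interior_target p \<and> quasi_strong_monotonicity (1 / \<alpha>0) p \<and>
      error_condition \<omega>M \<omega>B (3 * c / \<alpha>0) 0 p \<and> (\<delta> = 1 \<longrightarrow> 2 * (1 / \<alpha>0) * \<alpha>0 > 1)"
    if "p \<in> {proc}" for p
  proof -
    have "2 * (1 / \<alpha>0) * \<alpha>0 > 1" using \<alpha>0 by simp
    then show ?thesis
      using that process_data extended_recursion compactness ergodicity kernel_continuity growth
        interior_target quasi_strong_monotonicity error_condition by blast
  qed
  show ?thesis
    by (rule exI[of _ "{proc}"], rule exI[of _ 1], rule exI[of _ 1], rule exI[of _ 0],
        rule exI[of _ 1], rule exI[of _ 1], rule exI[of _ "1 / \<alpha>0"], rule exI[of _ "2 * c / \<alpha>0"],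
        rule exI[of _ "1 / \<alpha>0"], rule exI[of _ "3 * c / \<alpha>0"], rule exI[of _ 0])
      (intro conjI ballI allI impI bexI[of _ proc] tail conditions; simp)
qed

end
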